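(* Let $X$ be a compact metric space and $T:X\to X$ a homeomorphism. Suppose that there is a unique Borel probability measure $\mu$ on $X$ invariant under $T$, and that for every $f\in C(X)$ and every state $\varphi$ of $C(X)$, $$\lim_{n\to+\infty}\varphi(f\circ T^n)=\int f\,d\mu .$$ Then $(X,T)$ (with its Borel $\sigma$-algebra and the measure $\mu$) is conjugate to the trivial one-point dynamical system.
   Context: Measurable dynamical systems $(X_j,\mathcal A_j,\mu_j,T_j)$, $j=1,2$ (sets $X_j$, $\sigma$-algebras $\mathcal A_j$, probability measures $\mu_j$ on $\mathcal A_j$, measure-preserving invertible transformations $T_j$) are called conjugate if there exist sets $A_j\in\mathcal A_j$ of full measure with $T_j(A_j)=A_j$, and a one-to-one measure-preserving map $S:A_1\to A_2$ such that $T_2=S\circ T_1\circ S^{-1}$. The trivial one-point dynamical system is the identity map of a one-point probability space. *)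

theory Defs
  imports "HOL-Probability.Probability"
begin

(* Invertibility is understood in the measurable category: the set-theoretic inverse is
   required to be measurable as well (it then preserves the measure automatically). *)
definition invertible_measure_preserving ::
    "'a measure \<Rightarrow> 'b measure \<Rightarrow> ('a \<Rightarrow> 'b) \<Rightarrow> bool" where
  "invertible_measure_preserving M N S \<longleftrightarrow>
     bij_betw S (space M) (space N) \<and>
     S \<in> measurable M N \<and>
     the_inv_into (space M) S \<in> measurable N M \<and>
     distr M N S = N"

definition measurable_dynamical_system :: "'a measure \<Rightarrow> ('a \<Rightarrow> 'a) \<Rightarrow> bool" where
  "measurable_dynamical_system M T \<longleftrightarrow>
     prob_space M \<and> invertible_measure_preserving M M T"

(* The identity T2 = S o T1 o S^{-1} is an identity of maps on A2. *)
definition conjugate_systems ::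
    "'a measure \<Rightarrow> ('a \<Rightarrow> 'a) \<Rightarrow> 'b measure \<Rightarrow> ('b \<Rightarrow> 'b) \<Rightarrow> bool" where
  "conjugate_systems M1 T1 M2 T2 \<longleftrightarrow>
     measurable_dynamical_system M1 T1 \<and> measurable_dynamical_system M2 T2 \<and>
     (\<exists>A1\<in>sets M1. \<exists>A2\<in>sets M2.
        emeasure M1 A1 = 1 \<and> emeasure M2 A2 = 1 \<and>
        T1 ` A1 = A1 \<and> T2 ` A2 = A2 \<and>
        (\<exists>S. invertible_measure_preserving (restrict_space M1 A1) (restrict_space M2 A2) S \<and>
             (\<forall>y\<in>A2. T2 y = S (T1 (the_inv_into A1 S y)))))"

definition one_point_measure :: "unit measure" where
  "one_point_measure = return (count_space UNIV) ()"

definition invariant_borel_prob ::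
    "('a::topological_space \<Rightarrow> 'a) \<Rightarrow> 'a measure \<Rightarrow> bool" where
  "invariant_borel_prob T M \<longleftrightarrow>
     sets M = sets borel \<and> prob_space M \<and> distr M M T = M"

(* States of the unital C*-algebra C(X) of complex-valued continuous functions on the compact
   space X = UNIV: complex-linear, positive, unital functionals.  The functional is represented
   by a map on all functions; its values off C(X) are irrelevant. *)
definition state_on_C :: "(('a::topological_space \<Rightarrow> complex) \<Rightarrow> complex) \<Rightarrow> bool" where
  "state_on_C \<phi> \<longleftrightarrow>
     (\<forall>f g. continuous_on UNIV f \<longrightarrow> continuous_on UNIV g \<longrightarrow>
        \<phi> (\<lambda>x. f x + g x) = \<phi> f + \<phi> g) \<and>
     (\<forall>c f. continuous_on UNIV f \<longrightarrow> \<phi> (\<lambda>x. c * f x) = c * \<phi> f) \<and>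
     (\<forall>f. continuous_on UNIV f \<longrightarrow> (\<forall>x. f x \<in> \<real>\<^sub>\<ge>\<^sub>0) \<longrightarrow> \<phi> f \<in> \<real>\<^sub>\<ge>\<^sub>0) \<and>
     \<phi> (\<lambda>x. 1) = 1"

end

theory Submission
  imports Defs
begin

text \<open>Point evaluations are states, so \<open>f (T\<^sup>n x) \<longrightarrow> \<integral> f d\<mu>\<close> for every point \<open>x\<close>. By compactness the orbit
  of \<open>x\<close> has a limit point \<open>p\<close>, whence \<open>f p = \<integral> f d\<mu>\<close> for all continuous \<open>f\<close>. Taking for \<open>f\<close> the
  distance to \<open>p\<close> shows that \<open>\<mu>\<close> is concentrated at \<open>p\<close>, and invariance of \<open>\<mu>\<close> makes \<open>p\<close> a fixed point.\<close>

lemma state_on_C_eval: "state_on_C (\<lambda>f. f x)"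
  unfolding state_on_C_def by simp

text \<open>Along a convergent subsequence of the orbit of \<open>x\<close>, the values of a
  continuous \<open>f\<close> tend both to \<open>L f\<close> and to \<open>f p\<close>. The
  subsequence is extracted before \<open>f\<close> is chosen, so a single \<open>p\<close> serves
  all \<open>f\<close>.\<close>

lemma limit_point_evaluates_integral:
  fixes T :: "'a::metric_space \<Rightarrow> 'a" and L :: "('a \<Rightarrow> complex) \<Rightarrow> complex"
  assumes "compact (UNIV :: 'a set)"
    and lim: "\<And>f. continuous_on UNIV f \<Longrightarrow> (\<lambda>n. f ((T ^^ n) x)) \<longlonglongrightarrow> L f"
  obtains p where "\<And>f. continuous_on UNIV f \<Longrightarrow> L f = f p"
proof -
  obtain p r where r: "strict_mono (r :: nat \<Rightarrow> nat)" and p: "((\<lambda>n. (T ^^ n) x) \<circ> r) \<longlonglongrightarrow> p"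
    using assms(1) unfolding compact_def by blast
  have "L f = f p" if f: "continuous_on UNIV f" for f
  proof (rule LIMSEQ_unique)
    show "(\<lambda>n. f ((T ^^ r n) x)) \<longlonglongrightarrow> L f"
      using LIMSEQ_subseq_LIMSEQ[OF lim[OF f] r] by (simp add: o_def)
    show "(\<lambda>n. f ((T ^^ r n) x)) \<longlonglongrightarrow> f p"
      using continuous_on_tendsto_compose[OF f p] by (simp add: o_def)
  qed
  then show thesis by (rule that)
qed

text \<open>A nonnegative integrable function with integral 0 vanishes almost everywhere, and the
  distance to \<open>p\<close> vanishes only at \<open>p\<close>.\<close>

lemma emeasure_singleton_eq_1:
  fixes M :: "'a::metric_space measure"
  assumes "compact (UNIV :: 'a set)" and "prob_space M" and sets: "sets M = sets borel"
    and int0: "(LINT x|M. dist x p) = 0"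
  shows "emeasure M {p} = 1"
proof -
  interpret prob_space M by fact
  have cont: "continuous_on UNIV (\<lambda>x. dist x p)" by (intro continuous_intros)
  then have meas: "(\<lambda>x. dist x p) \<in> borel_measurable M"
    using borel_measurable_continuous_onI measurable_cong_sets[OF sets refl] by blast
  \<comment> \<open>Compactness bounds the distance and thus makes it integrable. The integral of a
    non-integrable function is 0 by convention, so \<open>int0\<close> becomes informative only
    through this.\<close>
  have "bounded ((\<lambda>x. dist x p) ` UNIV)"
    using cont assms(1) compact_continuous_image compact_imp_bounded by blast
  then obtain B where "\<And>x. norm (dist x p) \<le> B"
    by (auto simp: bounded_iff)
  then have "integrable M (\<lambda>x. dist x p)"
    using meas by (intro integrable_const_bound[where B=B]) auto
  then have "AE x in M. x = p"
    using int0 integral_nonneg_eq_0_iff_AE[of M "\<lambda>x. dist x p"] by simp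
  moreover have "{p} \<in> sets M" by (simp add: sets)
  ultimately show ?thesis using prob_eq_1[of "{p}"] by (simp add: emeasure_eq_measure)
qed

lemma invariant_atom_fixed:
  assumes M: "invariant_borel_prob T M" and T: "T \<in> borel_measurable borel"
    and p: "emeasure M {p :: 'a::t2_space} = 1"
  shows "T p = p"
proof (rule ccontr)
  assume ne: "T p \<noteq> p"
  from M have sets: "sets M = sets borel" and "prob_space M" and inv: "distr M M T = M"
    by (auto simp: invariant_borel_prob_def)
  interpret prob_space M by fact
  note [measurable_cong] = sets
  have [simp]: "space M = UNIV" using sets_eq_imp_space_eq[OF sets] by simp
  have [measurable]: "T \<in> measurable M M" using T measurable_cong_sets[OF sets sets] by blast
  have [measurable]: "{p} \<in> sets M" "T -` {p} \<in> sets M"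
    using measurable_sets[of T M M "{p}"] by (simp_all add: sets)
  have "emeasure M (T -` {p}) = 1"
    using p emeasure_distr[of T M M "{p}"] inv by simp
  then have "emeasure M ({p} \<union> T -` {p}) = 1 + 1"
    using p ne by (subst plus_emeasure[symmetric]) auto
  then show False using emeasure_le_1[of "{p} \<union> T -` {p}"] by simp
qed

lemma invertible_measure_preserving_to_one_point:
  assumes p: "{p} \<in> sets M" "emeasure M {p} = 1"
  shows "invertible_measure_preserving (restrict_space M {p})
           (restrict_space one_point_measure UNIV) (\<lambda>_. ())"
proof -
  let ?M = "restrict_space M {p}" and ?N = "restrict_space one_point_measure UNIV"
  have spM: "space ?M = {p}" using sets.sets_into_space[OF p(1)] by (auto simp: space_restrict_space)
  have N: "?N = one_point_measure"
    by (rule measure_eqI)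
      (auto simp: sets_restrict_space emeasure_restrict_space one_point_measure_def)
  have setsN: "sets ?N = sets (count_space UNIV)" by (simp only: N) (simp add: one_point_measure_def)
  have spN: "space ?N = UNIV" using sets_eq_imp_space_eq[OF setsN] by simp
  have meas: "(\<lambda>_. ()) \<in> measurable ?M ?N" by (simp add: spN)
  have bij: "bij_betw (\<lambda>_. ()) (space ?M) (space ?N)"
    unfolding spM spN by (auto simp: bij_betw_def)
  \<comment> \<open>The inverse is constantly \<open>p\<close>, and every subset of the one-point
    space is measurable, so measurability of the inverse only asks that its values lie in
    \<open>{p}\<close>.\<close>
  have "the_inv_into {p} (\<lambda>_. ()) y = p" for y
    by (rule the_inv_into_f_eq) auto
  then have inv: "the_inv_into (space ?M) (\<lambda>_. ()) \<in> measurable ?N ?M"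
    unfolding spM using spM by (simp add: measurable_cong_sets[OF setsN refl])
  have "distr ?M ?N (\<lambda>_. ()) = ?N"
  proof (rule measure_eqI)
    fix A assume "A \<in> sets (distr ?M ?N (\<lambda>_. ()))"
    then have A: "A \<in> sets ?N" by simp
    \<comment> \<open>With only these two sets to test, measure preservation reduces to equality of
      the total masses, both 1.\<close>
    have "A = {} \<or> A = UNIV" by auto
    then show "emeasure (distr ?M ?N (\<lambda>_. ())) A = emeasure ?N A"
      using A p meas by (auto simp: emeasure_distr spM N emeasure_restrict_space sets_restrict_space)
        (auto simp: one_point_measure_def emeasure_restrict_space)
  qed simp
  then show ?thesis using bij meas inv unfolding invertible_measure_preserving_def by blast
qed

lemma measurable_dynamical_system_one_point: "measurable_dynamical_system one_point_measure id"
proof -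
  have "distr one_point_measure one_point_measure id = one_point_measure"
    using distr_id[of one_point_measure] by (simp only: id_def)
  moreover have "the_inv_into UNIV id = (id :: unit \<Rightarrow> unit)"
    by (rule ext) simp
  ultimately show ?thesis
    unfolding measurable_dynamical_system_def invertible_measure_preserving_def
    by (simp only:) (simp add: one_point_measure_def prob_space_return)
qed

text \<open>Both \<open>T\<close> and \<open>inv T\<close> are continuous, hence Borel measurable,
  and bijectivity identifies \<open>inv T\<close> with the \<open>the_inv_into\<close> of the
  definition.\<close>

lemma measurable_dynamical_system_homeomorphism:
  fixes T :: "'a::topological_space \<Rightarrow> 'a"
  assumes T: "homeomorphism UNIV UNIV T (inv T)" and M: "invariant_borel_prob T M"
  shows "measurable_dynamical_system M T"
proof -
  from M have sets: "sets M = sets borel" by (simp add: invariant_borel_prob_def)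
  have sp: "space M = UNIV" using sets_eq_imp_space_eq[OF sets] by simp
  have "bij T" using T by (intro o_bij[of "inv T"]) (auto simp: homeomorphism_def fun_eq_iff)
  moreover have "the_inv_into UNIV T = inv T"
    using \<open>bij T\<close> by (auto simp: bij_def intro: the_inv_into_f_eq surj_f_inv_f)
  moreover have "T \<in> measurable M M" "inv T \<in> measurable M M"
    using T by (auto simp: homeomorphism_def measurable_cong_sets[OF sets sets]
        intro: borel_measurable_continuous_onI)
  ultimately show ?thesis
    using M unfolding measurable_dynamical_system_def invertible_measure_preserving_def
    by (simp add: sp invariant_borel_prob_def)
qed

theorem theorem4p2:
  fixes T :: "'a::metric_space \<Rightarrow> 'a" and \<mu> :: "'a measure"
  assumes "compact (UNIV :: 'a set)"
    and "homeomorphism UNIV UNIV T (inv T)"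
    and "invariant_borel_prob T \<mu>"
    and "\<And>\<nu>. invariant_borel_prob T \<nu> \<Longrightarrow> \<nu> = \<mu>"
    and "\<And>(f :: 'a \<Rightarrow> complex) \<phi>. continuous_on UNIV f \<Longrightarrow> state_on_C \<phi> \<Longrightarrow>
           (\<lambda>n. \<phi> (f \<circ> (T ^^ n))) \<longlonglongrightarrow> (LINT x|\<mu>. f x)"
  shows "conjugate_systems \<mu> T one_point_measure id"
proof -
  from assms(3) have sets: "sets \<mu> = sets borel" and prob: "prob_space \<mu>"
    by (auto simp: invariant_borel_prob_def)
  have T: "T \<in> borel_measurable borel"
    using assms(2) by (auto simp: homeomorphism_def intro: borel_measurable_continuous_onI)
  have "(\<lambda>n. f ((T ^^ n) x)) \<longlonglongrightarrow> (LINT x|\<mu>. f x)"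
    if "continuous_on UNIV f" for f :: "'a \<Rightarrow> complex" and x
    using assms(5)[OF that state_on_C_eval[of x]] by simp
  then obtain p where p: "\<And>f :: 'a \<Rightarrow> complex. continuous_on UNIV f \<Longrightarrow> (LINT x|\<mu>. f x) = f p"
    using limit_point_evaluates_integral[OF assms(1), of T _ "\<lambda>f. LINT x|\<mu>. f x"] by metis
  \<comment> \<open>The integral formula holds for complex-valued functions, so the distance is
    embedded into the complex numbers; its value at \<open>p\<close> is
    \<open>dist p p = 0\<close>.\<close>
  have "(LINT x|\<mu>. complex_of_real (dist x p)) = 0"
    by (subst p) (auto intro!: continuous_intros)
  then have 1: "emeasure \<mu> {p} = 1"
    using emeasure_singleton_eq_1[OF assms(1) prob sets] by simp
  have fixed: "T p = p"
    using invariant_atom_fixed[OF assms(3) T 1] .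
  have pm: "{p} \<in> sets \<mu>" by (simp add: sets)
  show ?thesis
    unfolding conjugate_systems_def
  \<comment> \<open>The full-measure sets are \<open>{p}\<close>, invariant because \<open>p\<close>
    is fixed, and the whole one-point space. The conjugating map is the constant one, and the
    intertwining identity holds since \<open>unit\<close> has a single element.\<close>
  proof (intro conjI bexI[of _ "{p}"] bexI[of _ UNIV] exI[of _ "\<lambda>_. ()"])
    show "measurable_dynamical_system \<mu> T"
      by (rule measurable_dynamical_system_homeomorphism[OF assms(2,3)])
    show "measurable_dynamical_system one_point_measure id"
      by (rule measurable_dynamical_system_one_point)
    show "invertible_measure_preserving (restrict_space \<mu> {p})
        (restrict_space one_point_measure UNIV) (\<lambda>_. ())"
      using invertible_measure_preserving_to_one_point[OF pm 1] .
    show "UNIV \<in> sets one_point_measure" "emeasure one_point_measure UNIV = 1"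
      by (simp_all add: one_point_measure_def)
    show "id ` (UNIV :: unit set) = UNIV" by (rule surj_id)
  qed (use pm 1 fixed in simp_all)
qed

end
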